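(* Let $\mathcal{B}\subseteq\mathbb{N}$ be a non-empty primitive set. Then $\varphi(H)\subseteq[\varphi_{W'},\varphi]\subseteq X_\varphi$; in particular $X_\varphi=\overline{[\varphi_{W'},\varphi]}$.
   Context: $\mathbb{N}=\{1,2,\dots\}$. A set $\mathcal{B}\subseteq\mathbb{N}$ is primitive if there are no distinct $b,b'\in\mathcal{B}$ with $b\mid b'$. Let $\Delta:\mathbb{Z}\to\prod_{b\in\mathcal{B}}\mathbb{Z}/b\mathbb{Z}$, $\Delta(n)=(n,n,\dots)$, be the canonical diagonal embedding (the product carries the product topology of discrete finite groups), and let $H:=\overline{\Delta(\mathbb{Z})}$, a compact abelian group. For $h\in H$, $h_b\in\mathbb{Z}/b\mathbb{Z}$ denotes its $b$-coordinate. The window is $W:=\{h\in H: h_b\neq 0\ \text{for all } b\in\mathcal{B}\}$, and $W':=\overline{\operatorname{int}(W)}$ (interior and closure in $H$). For $A\subseteq H$ the coding function $\varphi_A:H\to\{0,1\}^{\mathbb{Z}}$ is defined by $\varphi_A(h)(n)=1$ if and only if $h+\Delta(n)\in A$. Write $\varphi:=\varphi_W$. Let $X_\varphi:=\overline{\varphi(H)}\subseteq\{0,1\}^{\mathbb{Z}}$ (closure in the product topology). With $\leqslant$ denoting the coordinatewise order on $\{0,1\}^{\mathbb{Z}}$, put $[\varphi_{W'},\varphi]:=\{x\in\{0,1\}^{\mathbb{Z}}:\exists h\in H\text{ such that }\varphi_{W'}(h)\leqslant x\leqslant\varphi(h)\}$. *)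

theory Defs
  imports "HOL-Analysis.Analysis" "HOL-Algebra.Product_Groups"
begin

definition primitive :: "nat set \<Rightarrow> bool" where
  "primitive B \<longleftrightarrow> (\<forall>b\<in>B. \<forall>b'\<in>B. b \<noteq> b' \<longrightarrow> \<not> b dvd b')"

text \<open>The cyclic group of order \<open>b > 0\<close> is the library's group on the residues
  \<open>{0..<int b}\<close>, so an element of the product is an extensional function on \<open>B\<close> whose
  value at \<open>b\<close> is the reduced representative of its \<open>b\<close>-coordinate. The definitions
  below are meant for \<open>B\<close> not containing \<open>0\<close>.\<close>

definition prod_grp :: "nat set \<Rightarrow> (nat \<Rightarrow> int) monoid" where
  "prod_grp B = product_group B integer_mod_group"

definition prod_top :: "nat set \<Rightarrow> (nat \<Rightarrow> int) topology" where
  "prod_top B = product_topology (\<lambda>b. discrete_topology (carrier (integer_mod_group b))) B"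

definition Delta :: "nat set \<Rightarrow> int \<Rightarrow> (nat \<Rightarrow> int)" where
  "Delta B n = (\<lambda>b\<in>B. n mod int b)"

definition H :: "nat set \<Rightarrow> (nat \<Rightarrow> int) set" where
  "H B = prod_top B closure_of (range (Delta B))"

definition H_top :: "nat set \<Rightarrow> (nat \<Rightarrow> int) topology" where
  "H_top B = subtopology (prod_top B) (H B)"

definition W :: "nat set \<Rightarrow> (nat \<Rightarrow> int) set" where
  "W B = {h \<in> H B. \<forall>b\<in>B. h b \<noteq> 0}"

definition W' :: "nat set \<Rightarrow> (nat \<Rightarrow> int) set" where
  "W' B = H_top B closure_of (H_top B interior_of W B)"

definition shift_space :: "(int \<Rightarrow> nat) topology" where
  "shift_space = product_topology (\<lambda>_. discrete_topology {0, 1}) UNIV"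

definition coding :: "nat set \<Rightarrow> (nat \<Rightarrow> int) set \<Rightarrow> (nat \<Rightarrow> int) \<Rightarrow> (int \<Rightarrow> nat)" where
  "coding B A h = (\<lambda>n. if h \<otimes>\<^bsub>prod_grp B\<^esub> Delta B n \<in> A then 1 else 0)"

definition X_phi :: "nat set \<Rightarrow> (int \<Rightarrow> nat) set" where
  "X_phi B = shift_space closure_of (coding B (W B) ` H B)"

text \<open>The order on \<open>int \<Rightarrow> nat\<close> is the library's pointwise order.\<close>

definition coding_interval :: "nat set \<Rightarrow> (int \<Rightarrow> nat) set" where
  "coding_interval B =
    {x \<in> topspace shift_space. \<exists>h\<in>H B. coding B (W' B) h \<le> x \<and> x \<le> coding B (W B) h}"

end

theory Submission
  imports Defs "HOL-Number_Theory.Residues"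
begin

text \<open>
  Write \<open>h + n\<close> for the translate of \<open>h \<in> H\<close> by \<open>\<Delta>(n)\<close>. The inclusion
  \<open>\<phi>(H) \<subseteq> [\<phi>\<^bsub>W'\<^esub>, \<phi>]\<close> only needs \<open>W' \<subseteq> W\<close>, which holds because \<open>W\<close> is closed, and the
  statement about closures follows formally from the two inclusions. The content is \<open>[\<phi>\<^bsub>W'\<^esub>, \<phi>] \<subseteq> X\<^bsub>\<phi>\<^esub>\<close>: given
  \<open>\<phi>\<^bsub>W'\<^esub>(h) \<le> x \<le> \<phi>(h)\<close> and a finite set of positions, some \<open>h' \<in> H\<close> must satisfy
  \<open>h' + n \<notin> W\<close> at the positions \<open>n\<close> with \<open>x n = 0\<close>, where \<open>h + n \<notin> W'\<close>, and
  \<open>h' + p \<in> W\<close> at those with \<open>x p = 1\<close>, where \<open>h + p \<in> W\<close>.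

  Near a point \<open>h + n \<notin> W'\<close> there are no interior points of \<open>W\<close>, so \<open>h\<close> can be moved by arbitrarily
  little to force \<open>h + n\<close> out of \<open>W\<close>. Since leaving \<open>W\<close> is an open condition, the positions \<open>n\<close>
  can be treated one after the other. The difficulty is to keep every \<open>h + p\<close> inside \<open>W\<close>, although
  \<open>W\<close> need not be open; this is lemma \<open>perturb_out_of_window\<close>. There \<open>g = h + n\<close> has to become divisible by some
  \<open>b\<^sub>0 \<in> B\<close>, while being kept modulo a given \<open>\<ell>\<close>. As \<open>g\<close> is not interior to \<open>W\<close>, the residue of
  \<open>g\<close> modulo \<open>\<ell>\<close> does not prevent this for a suitable \<open>b\<^sub>0\<close>, so \<open>gcd(b\<^sub>0, \<ell>)\<close> divides \<open>g\<close>. Put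
  \<open>r = b\<^sub>0 / gcd(b\<^sub>0, \<ell>)\<close> and multiply \<open>g\<close> by the limit of the powers \<open>r\<^bsup>k!\<^esup>\<close>. This limit is the
  idempotent profinite integer that is \<open>0\<close> at the primes dividing \<open>r\<close> and \<open>1\<close> at all others, so the new
  \<open>g'\<close> is \<open>0\<close> at the primes dividing \<open>r\<close> and unchanged elsewhere. At a prime \<open>q\<close> dividing \<open>r\<close>, the
  numbers \<open>g' + d\<close> and \<open>d\<close> have the same valuation for each difference
  \<open>d = p - n \<noteq> 0\<close>. If \<open>\<ell>\<close> was chosen to be a multiple of \<open>gcd(b, d)\<close> for all \<open>b \<in> B\<close> and the finitely many
  \<open>d\<close> in question, then no \<open>b \<in> B\<close> can divide \<open>g' + d\<close> unless it already divides \<open>g + d\<close>.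
\<close>

section \<open>Products of discrete spaces\<close>

lemma openin_product_discrete_iff:
  "openin (product_topology (\<lambda>i. discrete_topology (A i)) I) U \<longleftrightarrow>
     U \<subseteq> Pi\<^sub>E I A \<and>
     (\<forall>x\<in>U. \<exists>S. finite S \<and> S \<subseteq> I \<and> (\<forall>y\<in>Pi\<^sub>E I A. (\<forall>i\<in>S. y i = x i) \<longrightarrow> y \<in> U))"
  (is "?L \<longleftrightarrow> ?R")
proof
  assume L: ?L
  have "U \<subseteq> Pi\<^sub>E I A"
    using openin_subset[OF L] by simp
  moreover have "\<exists>S. finite S \<and> S \<subseteq> I \<and> (\<forall>y\<in>Pi\<^sub>E I A. (\<forall>i\<in>S. y i = x i) \<longrightarrow> y \<in> U)"
    if "x \<in> U" for x
  proof -
    from L[unfolded openin_product_topology_alt, rule_format, OF that]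
    obtain V where V: "finite {i \<in> I. V i \<noteq> A i}" "x \<in> Pi\<^sub>E I V" "Pi\<^sub>E I V \<subseteq> U"
      by (auto simp del: openin_discrete_topology)
    have "y \<in> U" if y: "y \<in> Pi\<^sub>E I A" "\<forall>i\<in>{i \<in> I. V i \<noteq> A i}. y i = x i" for y
    proof -
      have "y i \<in> V i" if "i \<in> I" for i
        using y(2) PiE_mem[OF y(1) that] PiE_mem[OF V(2) that] that by (cases "V i = A i") auto
      then have "y \<in> Pi\<^sub>E I V"
        using y(1) by (simp add: PiE_iff)
      then show ?thesis
        using V(3) by blast
    qed
    then show ?thesis
      using V(1) by (intro exI[of _ "{i \<in> I. V i \<noteq> A i}"]) auto
  qed
  ultimately show ?R by simp
next
  assume R: ?R
  show ?L
    unfolding openin_product_topology_alt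
  proof
    fix x assume x: "x \<in> U"
    from R[THEN conjunct2, rule_format, OF x] obtain S where S: "finite S" "S \<subseteq> I"
      "\<And>y. y \<in> Pi\<^sub>E I A \<Longrightarrow> \<forall>i\<in>S. y i = x i \<Longrightarrow> y \<in> U" by auto
    have xA: "x \<in> Pi\<^sub>E I A" using R x by blast
    define V where "V i = (if i \<in> S then {x i} else A i)" for i
    have "Pi\<^sub>E I V \<subseteq> U"
    proof
      fix y assume y: "y \<in> Pi\<^sub>E I V"
      have "y i = x i" if "i \<in> S" for i
        using PiE_mem[OF y, of i] S(2) that by (auto simp: V_def)
      moreover have "y i \<in> A i" if "i \<in> I" for i
        using PiE_mem[OF y that] PiE_mem[OF xA that] by (auto simp: V_def split: if_splits)
      then have "y \<in> Pi\<^sub>E I A"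
        using y by (auto simp: PiE_iff)
      ultimately show "y \<in> U" using S(3) by blast
    qed
    moreover have "finite {i \<in> I. V i \<noteq> A i}"
      by (rule finite_subset[OF _ S(1)]) (auto simp: V_def)
    moreover have "x \<in> Pi\<^sub>E I V" "\<forall>i\<in>I. V i \<subseteq> A i"
      using xA by (auto simp: V_def PiE_iff)
    ultimately show "\<exists>V. finite {i \<in> I. V i \<noteq> topspace (discrete_topology (A i))} \<and>
        (\<forall>i\<in>I. openin (discrete_topology (A i)) (V i)) \<and> x \<in> Pi\<^sub>E I V \<and> Pi\<^sub>E I V \<subseteq> U"
      by (intro exI[of _ V]) auto
  qed
qed

lemma openin_product_discrete_cylinder:
  assumes "finite S" "S \<subseteq> I"
  shows "openin (product_topology (\<lambda>i. discrete_topology (A i)) I)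
           {y \<in> Pi\<^sub>E I A. \<forall>i\<in>S. y i = x i}"
  unfolding openin_product_discrete_iff using assms by (auto intro!: exI[of _ S])

lemma in_closure_of_product_discrete_iff:
  assumes "Y \<subseteq> Pi\<^sub>E I A"
  shows "x \<in> product_topology (\<lambda>i. discrete_topology (A i)) I closure_of Y \<longleftrightarrow>
    x \<in> Pi\<^sub>E I A \<and> (\<forall>S. finite S \<longrightarrow> S \<subseteq> I \<longrightarrow> (\<exists>y\<in>Y. \<forall>i\<in>S. y i = x i))" (is "?L \<longleftrightarrow> ?R")
proof
  assume L: ?L
  show ?R
  proof (intro conjI allI impI)
    show xA: "x \<in> Pi\<^sub>E I A" using L by (simp add: in_closure_of)
    fix S assume "finite S" "S \<subseteq> I"
    note cylinder = openin_product_discrete_cylinder[OF this, of A x]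
    have "x \<in> {y \<in> Pi\<^sub>E I A. \<forall>i\<in>S. y i = x i}" using xA by simp
    with cylinder L[unfolded in_closure_of, THEN conjunct2]
    have "\<exists>y. y \<in> Y \<and> y \<in> {y \<in> Pi\<^sub>E I A. \<forall>i\<in>S. y i = x i}" by meson
    then show "\<exists>y\<in>Y. \<forall>i\<in>S. y i = x i" by auto
  qed
next
  assume R: ?R
  show ?L
    unfolding in_closure_of
  proof (intro conjI allI impI)
    show "x \<in> topspace (product_topology (\<lambda>i. discrete_topology (A i)) I)" using R by simp
    fix U assume U: "x \<in> U \<and> openin (product_topology (\<lambda>i. discrete_topology (A i)) I) U"
    then obtain S where S: "finite S" "S \<subseteq> I"
      "\<And>y. y \<in> Pi\<^sub>E I A \<Longrightarrow> \<forall>i\<in>S. y i = x i \<Longrightarrow> y \<in> U"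
      unfolding openin_product_discrete_iff by metis
    from R S(1,2) obtain y where "y \<in> Y" "\<forall>i\<in>S. y i = x i" by metis
    with S(3) assms show "\<exists>y. y \<in> Y \<and> y \<in> U" by blast
  qed
qed

section \<open>The group and its window\<close>

definition translate :: "nat set \<Rightarrow> int \<Rightarrow> (nat \<Rightarrow> int) \<Rightarrow> (nat \<Rightarrow> int)" where
  "translate B n h = (\<lambda>b\<in>B. (h b + n) mod int b)"

lemma translate_apply: "b \<in> B \<Longrightarrow> translate B n h b = (h b + n) mod int b"
  by (simp add: translate_def)

lemma coding_eq: "coding B A h n = (if translate B n h \<in> A then 1 else 0)"
proof -
  have "h \<otimes>\<^bsub>prod_grp B\<^esub> Delta B n = translate B n h"
    unfolding translate_def prod_grp_def Delta_def mult_product_group mult_integer_mod_group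
    by (rule restrict_ext) (simp add: mod_add_right_eq)
  then show ?thesis by (simp add: coding_def)
qed

text \<open>All later arguments take place in finitely many coordinates at a time, where an element of \<open>H\<close>
  is an ordinary integer.\<close>

lemma in_H_iff:
  assumes "0 \<notin> B"
  shows "h \<in> H B \<longleftrightarrow> h \<in> extensional B \<and>
    (\<forall>T. finite T \<longrightarrow> T \<subseteq> B \<longrightarrow> (\<exists>m. \<forall>b\<in>T. h b = m mod int b))" (is "?L \<longleftrightarrow> ?R")
proof -
  let ?C = "\<lambda>b. carrier (integer_mod_group b)"
  have pos: "int b > 0" if "b \<in> B" for b
    using assms that by (cases "b = 0") auto
  have D: "range (Delta B) \<subseteq> Pi\<^sub>E B ?C"
    using pos by (auto simp: Delta_def carrier_integer_mod_group)
  have eq: "h \<in> H B \<longleftrightarrow> h \<in> Pi\<^sub>E B ?C \<and>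
      (\<forall>T. finite T \<longrightarrow> T \<subseteq> B \<longrightarrow> (\<exists>m. \<forall>b\<in>T. Delta B m b = h b))"
    unfolding H_def prod_top_def in_closure_of_product_discrete_iff[OF D] by auto
  have Delta: "Delta B m b = m mod int b" if "b \<in> B" for m b
    using that by (simp add: Delta_def)
  show ?thesis
  proof
    assume L: ?L
    show ?R
    proof (intro conjI allI impI)
      show "h \<in> extensional B" using L eq by (simp add: PiE_def)
      fix T assume "finite T" "T \<subseteq> B"
      with L eq obtain m where "\<forall>b\<in>T. Delta B m b = h b" by blast
      with \<open>T \<subseteq> B\<close> Delta show "\<exists>m. \<forall>b\<in>T. h b = m mod int b" by (metis subsetD)
    qed
  next
    assume R: ?R
    have "h b \<in> ?C b" if b: "b \<in> B" for b
    proof -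
      from R[THEN conjunct2, rule_format, of "{b}"] b obtain m where "h b = m mod int b" by auto
      with pos[OF b] show ?thesis by (simp add: carrier_integer_mod_group)
    qed
    moreover have "\<exists>m. \<forall>b\<in>T. Delta B m b = h b" if T: "finite T" "T \<subseteq> B" for T
      using R T Delta by (metis subsetD)
    ultimately show ?L
      using R eq by (simp add: PiE_def)
  qed
qed

lemma H_integer_approx:
  assumes "0 \<notin> B" "h \<in> H B" "finite T" "T \<subseteq> B"
  obtains m where "\<And>b. b \<in> T \<Longrightarrow> h b = m mod int b"
proof -
  have "\<exists>m. \<forall>b\<in>T. h b = m mod int b"
    using assms(2)[unfolded in_H_iff[OF assms(1)]] assms(3,4) by simp
  then show ?thesis using that by blast
qed

lemma H_mod_self:
  assumes "0 \<notin> B" "h \<in> H B" "b \<in> B"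
  shows "h b mod int b = h b"
  by (rule H_integer_approx[of B h "{b}"]) (use assms in auto)

lemma translate_in_H:
  assumes B: "0 \<notin> B" and h: "h \<in> H B"
  shows "translate B n h \<in> H B"
  unfolding in_H_iff[OF B]
proof (intro conjI allI impI)
  fix T assume T: "finite T" "T \<subseteq> B"
  obtain m where m: "\<And>b. b \<in> T \<Longrightarrow> h b = m mod int b"
    using H_integer_approx[OF B h T] by blast
  have "\<forall>b\<in>T. translate B n h b = (m + n) mod int b"
    using m T(2) by (auto simp: translate_apply mod_add_left_eq)
  then show "\<exists>m. \<forall>b\<in>T. translate B n h b = m mod int b" by blast
qed (simp add: translate_def)

lemma translate_translate:
  "translate B m (translate B n h) = translate B (n + m) h"
  unfolding translate_def by (auto simp: mod_add_left_eq add.assoc)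

lemma translate_zero:
  assumes "0 \<notin> B" "h \<in> H B"
  shows "translate B 0 h = h"
proof
  fix b
  show "translate B 0 h b = h b"
    using assms in_H_iff[OF assms(1)] H_mod_self[OF assms]
    by (cases "b \<in> B") (auto simp: translate_def extensional_def)
qed

lemma translate_in_W_iff:
  assumes "0 \<notin> B" "h \<in> H B"
  shows "translate B n h \<in> W B \<longleftrightarrow> (\<forall>b\<in>B. \<not> int b dvd h b + n)"
  using translate_in_H[OF assms] by (auto simp: W_def translate_apply dvd_eq_mod_eq_0)

lemma openin_H_top_iff:
  "openin (H_top B) U \<longleftrightarrow> U \<subseteq> H B \<and>
     (\<forall>x\<in>U. \<exists>S. finite S \<and> S \<subseteq> B \<and> (\<forall>y\<in>H B. (\<forall>b\<in>S. y b = x b) \<longrightarrow> y \<in> U))" (is "?L \<longleftrightarrow> ?R")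
proof
  let ?C = "\<lambda>b. carrier (integer_mod_group b)"
  have HC: "H B \<subseteq> Pi\<^sub>E B ?C"
    using closure_of_subset_topspace unfolding H_def prod_top_def by force
  {
    assume ?L
    then obtain V where V: "openin (prod_top B) V" and U: "U = V \<inter> H B"
      unfolding H_top_def openin_subtopology by blast
    show ?R
    proof (intro conjI ballI)
      show "U \<subseteq> H B" using U by blast
      fix x assume "x \<in> U"
      then have "x \<in> V" using U by blast
      then obtain S where "finite S" "S \<subseteq> B"
        "\<And>y. y \<in> Pi\<^sub>E B ?C \<Longrightarrow> \<forall>b\<in>S. y b = x b \<Longrightarrow> y \<in> V"
        using V unfolding prod_top_def openin_product_discrete_iff by metis
      then show "\<exists>S. finite S \<and> S \<subseteq> B \<and> (\<forall>y\<in>H B. (\<forall>b\<in>S. y b = x b) \<longrightarrow> y \<in> U)"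
        using U HC by (intro exI[of _ S]) blast
    qed
  next
    assume R: ?R
    from bchoice[OF R[THEN conjunct2]]
    obtain S where SU: "\<forall>x\<in>U. finite (S x) \<and> S x \<subseteq> B \<and>
        (\<forall>y\<in>H B. (\<forall>b\<in>S x. y b = x b) \<longrightarrow> y \<in> U)" ..
    have S: "finite (S x)" "S x \<subseteq> B" if "x \<in> U" for x
      using SU[rule_format, OF that] by simp_all
    let ?V = "\<Union>x\<in>U. {y \<in> Pi\<^sub>E B ?C. \<forall>b\<in>S x. y b = x b}"
    have "openin (prod_top B) ?V"
      unfolding prod_top_def
      by (rule openin_Union) (auto dest: S intro!: openin_product_discrete_cylinder)
    moreover have "U = ?V \<inter> H B"
    proof
      show "U \<subseteq> ?V \<inter> H B" using R HC by auto
      show "?V \<inter> H B \<subseteq> U"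
      proof
        fix y assume "y \<in> ?V \<inter> H B"
        then obtain x where "x \<in> U" "y \<in> H B" "\<forall>b\<in>S x. y b = x b" by blast
        then show "y \<in> U" using SU by simp
      qed
    qed
    ultimately show ?L
      unfolding H_top_def openin_subtopology by blast
  }
qed

lemma topspace_H_top: "topspace (H_top B) = H B"
  unfolding H_top_def H_def by (simp add: closure_of_subset_topspace Int_absorb1)

lemma not_in_interior_W:
  assumes "g \<in> H B" "g \<notin> H_top B interior_of W B" "finite S" "S \<subseteq> B"
  obtains g' b where "g' \<in> H B" "\<And>c. c \<in> S \<Longrightarrow> g' c = g c" "b \<in> B" "g' b = 0"
proof -
  let ?U = "{y \<in> H B. \<forall>c\<in>S. y c = g c}"
  have "openin (H_top B) ?U"
    unfolding openin_H_top_iff using assms(3,4) by (auto intro!: exI[of _ S])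
  then have "\<not> ?U \<subseteq> W B"
    using assms(1,2) unfolding interior_of_def by blast
  then show ?thesis using that unfolding W_def by blast
qed

lemma not_in_W'_neighbourhood:
  assumes "g \<in> H B" "g \<notin> W' B"
  obtains S where "finite S" "S \<subseteq> B"
    "\<And>g'. g' \<in> H B \<Longrightarrow> \<forall>b\<in>S. g' b = g b \<Longrightarrow> g' \<notin> H_top B interior_of W B"
proof -
  from assms obtain U where U: "g \<in> U" "openin (H_top B) U" "U \<inter> H_top B interior_of W B = {}"
    unfolding W'_def in_closure_of topspace_H_top by blast
  from U(2)[unfolded openin_H_top_iff, THEN conjunct2, rule_format, OF U(1)]
  obtain S where S: "finite S" "S \<subseteq> B" "\<forall>y\<in>H B. (\<forall>b\<in>S. y b = g b) \<longrightarrow> y \<in> U" by blast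
  show ?thesis
    by (rule that[OF S(1,2)]) (use S(3) U(3) in blast)
qed

lemma W'_subset_W: "W' B \<subseteq> W B"
proof
  fix g assume g: "g \<in> W' B"
  then have gH: "g \<in> H B" by (simp add: W'_def in_closure_of topspace_H_top)
  have "g b \<noteq> 0" if b: "b \<in> B" for b
  proof -
    have "openin (H_top B) {y \<in> H B. y b = g b}"
      unfolding openin_H_top_iff using b by (auto intro!: exI[of _ "{b}"])
    moreover have "g \<in> {y \<in> H B. y b = g b}" using gH by simp
    ultimately have "\<exists>y. y \<in> H_top B interior_of W B \<and> y \<in> {y \<in> H B. y b = g b}"
      using g[unfolded W'_def in_closure_of, THEN conjunct2] by meson
    then obtain y where "y \<in> W B" "y b = g b"
      using interior_of_subset[of "H_top B" "W B"] by auto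
    with b show ?thesis by (auto simp: W_def)
  qed
  with gH show "g \<in> W B" by (simp add: W_def)
qed

section \<open>Powers tending to an idempotent\<close>

text \<open>Modulo \<open>b\<close> the powers of \<open>r\<close> with positive exponent divisible by \<open>b!\<close> are all the same idempotent:
  \<open>0\<close> modulo the part of \<open>b\<close> composed of primes dividing \<open>r\<close>, and \<open>1\<close>, by Euler's theorem, modulo
  the part coprime to \<open>r\<close>.\<close>

lemma split_at_base:
  fixes b r :: nat
  assumes "b > 0"
  shows "\<exists>x y. b = x * y \<and> x dvd r ^ b \<and> coprime r y"
  using assms
proof (induction b rule: less_induct)
  case (less b)
  show ?case
  proof (cases "coprime r b")
    case True
    then show ?thesis by (intro exI[of _ 1] exI[of _ b]) simp
  next
    case False
    define d where "d = gcd r b"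
    have d: "d > 1" using False less.prems by (metis d_def coprime_iff_gcd_eq_1 gcd_pos_nat less_one linorder_neqE_nat not_gr0)
    obtain b1 where b1: "b = d * b1" unfolding d_def by (meson dvdE gcd_dvd2)
    have lt: "b1 < b" "b1 > 0" using b1 d less.prems by auto
    obtain x y where xy: "b1 = x * y" "x dvd r ^ b1" "coprime r y" using less.IH[OF lt] by blast
    have "d * x dvd r ^ Suc b1" using xy(2) d_def by (simp add: mult_dvd_mono)
    also have "\<dots> dvd r ^ b" using lt by (intro le_imp_power_dvd) simp
    finally show ?thesis using xy b1 by (intro exI[of _ "d * x"] exI[of _ y]) simp
  qed
qed

lemma factorial_powers_idempotent:
  fixes b r :: nat
  assumes "b > 0"
  obtains x y where "b = x * y" "coprime x y" "coprime r y"
    "\<And>k. k > 0 \<Longrightarrow> fact b dvd k \<Longrightarrow> x dvd r ^ k"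
    "\<And>k. fact b dvd k \<Longrightarrow> [r ^ k = 1] (mod y)"
proof -
  obtain x y where xy: "b = x * y" "x dvd r ^ b" "coprime r y"
    using split_at_base[OF assms] by blast
  have y: "y > 0" using xy(1) assms by (cases y) auto
  have "coprime x y"
    using xy(2,3) by (metis coprime_divisors coprime_power_left_iff dvd_refl)
  moreover have "x dvd r ^ k" if k: "k > 0" "fact b dvd k" for k
  proof -
    have "b \<le> k" using fact_ge_self[of b] dvd_imp_le[OF k(2,1)] by linarith
    then show ?thesis using xy(2) le_imp_power_dvd dvd_trans by blast
  qed
  moreover have "[r ^ k = 1] (mod y)" if k: "fact b dvd k" for k
  proof -
    have "y \<le> b" using xy(1) assms by simp
    then have "totient y \<le> b" using totient_le[of y] by linarith
    then have "totient y dvd fact b" using y by (intro dvd_fact) (simp_all add: Suc_leI)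
    then obtain j where j: "k = totient y * j" using k by (meson dvdE dvd_trans)
    have "[(r ^ totient y) ^ j = 1 ^ j] (mod y)"
      using euler_theorem[OF xy(3)] cong_pow by blast
    then show ?thesis by (simp add: j power_mult)
  qed
  ultimately show ?thesis using that xy by blast
qed

lemma factorial_powers_stable:
  fixes b r L :: nat
  assumes "b > 0" "b \<le> L"
  shows "[r ^ fact L = r ^ fact b] (mod b)"
proof -
  obtain x y where xy: "b = x * y" "coprime x y"
    "\<And>k. k > 0 \<Longrightarrow> fact b dvd k \<Longrightarrow> x dvd r ^ k" "\<And>k. fact b dvd k \<Longrightarrow> [r ^ k = 1] (mod y)"
    using factorial_powers_idempotent[OF assms(1), of r] by metis
  have F: "fact b dvd (fact L :: nat)" using assms(2) by (rule fact_dvd)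
  have "[r ^ fact L = r ^ fact b] (mod x)"
    using xy(3)[of "fact L"] xy(3)[of "fact b"] F by (simp add: cong_def mod_eq_0_iff_dvd[symmetric])
  moreover have "[r ^ fact L = r ^ fact b] (mod y)"
    by (rule cong_trans[OF xy(4)[OF F] cong_sym[OF xy(4)[OF dvd_refl]]])
  ultimately show ?thesis unfolding xy(1) by (rule coprime_cong_mult_nat[OF _ _ xy(2)])
qed

text \<open>The exponent \<open>b!\<close> depends on the coordinate, but by stability one exponent \<open>L!\<close> serves any
  finitely many coordinates, which is what membership in \<open>H\<close> requires.\<close>

lemma times_idempotent_in_H:
  assumes B: "0 \<notin> B" and g: "g \<in> H B"
  shows "(\<lambda>b\<in>B. (g b * int r ^ fact b) mod int b) \<in> H B"
  unfolding in_H_iff[OF B]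
proof (intro conjI allI impI)
  fix T assume T: "finite T" "T \<subseteq> B"
  obtain m where m: "\<And>b. b \<in> T \<Longrightarrow> g b = m mod int b"
    using H_integer_approx[OF B g T] by blast
  define L where "L = Max (insert 0 T)"
  have "(g b * int r ^ fact b) mod int b = (m * int r ^ fact L) mod int b" if b: "b \<in> T" for b
  proof -
    have "b > 0" "b \<le> L" using b T B by (auto simp: L_def intro: gr0I)
    then have "[r ^ fact L = r ^ fact b] (mod b)" by (rule factorial_powers_stable)
    then have "[int (r ^ fact L) = int (r ^ fact b)] (mod int b)" by (simp only: cong_int_iff)
    then have "[int r ^ fact b = int r ^ fact L] (mod int b)" by (simp add: cong_sym)
    moreover have "[g b = m] (mod int b)" using m[OF b] by (simp add: cong_def)
    ultimately show ?thesis unfolding cong_def by (metis mod_mult_cong)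
  qed
  then show "\<exists>m. \<forall>b\<in>T. (\<lambda>b\<in>B. (g b * int r ^ fact b) mod int b) b = m mod int b"
    using T(2) by (intro exI[of _ "m * int r ^ fact L"]) auto
qed simp

section \<open>Leaving the window at one position only\<close>

text \<open>A divisor of \<open>\<ell>\<close> composed of primes of \<open>r\<close> divides \<open>gcd(b\<^sub>0, \<ell>)\<close>, because such
  primes occur in \<open>b\<^sub>0\<close> to a higher power than in \<open>\<ell>\<close>.\<close>

lemma dvd_gcd_of_dvd_power_quotient:
  fixes x l b0 k :: nat
  assumes "b0 > 0" "x dvd l" "x dvd (b0 div gcd b0 l) ^ k"
  shows "x dvd gcd b0 l"
proof -
  let ?c = "gcd b0 l"
  have "coprime (b0 div ?c) (l div ?c)" using assms(1) by (intro div_gcd_coprime) simp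
  then have "coprime x (l div ?c)"
    using assms(3) by (metis coprime_divisors coprime_power_left_iff dvd_refl)
  moreover have "x dvd ?c * (l div ?c)" using assms(2) by simp
  ultimately show ?thesis using coprime_dvd_mult_left_iff by blast
qed

text \<open>\<open>\<ell>\<close> is the least common multiple of \<open>S\<close> and of representatives of the finitely many values
  \<open>gcd(b, M)\<close>, where \<open>M\<close> is the product of the \<open>\<bar>d\<bar>\<close>. Building \<open>\<ell>\<close> from elements of \<open>B\<close> only is
  essential, since the coordinates of \<open>g\<close> carry no residue for other moduli; it still makes \<open>\<ell>\<close> a
  multiple of \<open>gcd(b, d)\<close> for all \<open>b \<in> B\<close>.\<close>

lemma perturb_out_of_window:
  assumes B: "0 \<notin> B" and g: "g \<in> H B" and gint: "g \<notin> H_top B interior_of W B"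
    and S: "finite S" "S \<subseteq> B" and D: "finite D" "0 \<notin> D"
  obtains g' where "g' \<in> H B" "\<And>b. b \<in> S \<Longrightarrow> g' b = g b" "g' \<notin> W B"
    "\<And>d. d \<in> D \<Longrightarrow> translate B d g \<in> W B \<Longrightarrow> translate B d g' \<in> W B"
proof -
  define M where "M = (\<Prod>d\<in>D. nat \<bar>d\<bar>)"
  have M: "M > 0" using D by (auto simp: M_def intro!: prod_pos)
  have dM: "d dvd int M" if "d \<in> D" for d
  proof -
    have "nat \<bar>d\<bar> dvd M" unfolding M_def using D(1) that by (rule dvd_prodI)
    then show ?thesis by (simp add: nat_abs_dvd_iff)
  qed
  have "(\<lambda>b. gcd b M) ` B \<subseteq> {..M}" using M by (auto intro: gcd_le2_nat)
  then have "finite ((\<lambda>b. gcd b M) ` B)" by (rule finite_subset) simp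
  from finite_subset_image[OF this subset_refl]
  obtain R where "R \<subseteq> B \<and> finite R \<and> (\<lambda>b. gcd b M) ` B = (\<lambda>b. gcd b M) ` R" ..
  then have R: "R \<subseteq> B" "finite R" "(\<lambda>b. gcd b M) ` B = (\<lambda>b. gcd b M) ` R"
    by (iprover elim: conjE)+
  define S1 where "S1 = S \<union> R"
  have S1: "finite S1" "S1 \<subseteq> B" using S R by (auto simp: S1_def)
  define l where "l = Lcm S1"
  have gcd_l: "gcd b M dvd l" if "b \<in> B" for b
  proof -
    have "gcd b M \<in> (\<lambda>b. gcd b M) ` R" unfolding R(3)[symmetric] using that by (rule imageI)
    then obtain s where s: "s \<in> R" "gcd b M = gcd s M" by (rule imageE)
    have "s dvd l" using s(1) by (auto simp: l_def S1_def intro: dvd_Lcm)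
    with s(2) show ?thesis by (metis dvd_trans gcd_dvd1)
  qed

  \<comment> \<open>Since \<open>g\<close> is not interior, no finite information about \<open>g\<close> excludes divisibility by some \<open>b0\<close>.\<close>
  obtain g1 b0 where g1: "g1 \<in> H B" "\<And>b. b \<in> S1 \<Longrightarrow> g1 b = g b" and b0: "b0 \<in> B" "g1 b0 = 0"
    using not_in_interior_W[OF g gint S1] by blast
  have b0pos: "b0 > 0" using b0(1) B by (auto intro: gr0I)
  define c where "c = gcd b0 l"
  define r where "r = b0 div c"
  have b0cr: "b0 = c * r" by (simp add: r_def c_def)
  \<comment> \<open>The statement \<open>c dvd g\<close>: it makes sense for the coordinates of \<open>g\<close> at multiples of \<open>c\<close>, and
     is spelled out at divisors \<open>x\<close> of \<open>c\<close> that also divide the modulus \<open>b\<close>.\<close>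
  have c_dvd: "int x dvd g b" if b: "b \<in> B" "x dvd b" and x: "x dvd c" for b x
  proof -
    obtain m where m: "\<And>a. a \<in> insert b S1 \<Longrightarrow> g a = m mod int a"
      using H_integer_approx[OF B g, of "insert b S1"] S1 b(1) by blast
    obtain m1 where m1: "\<And>a. a \<in> insert b0 S1 \<Longrightarrow> g1 a = m1 mod int a"
      using H_integer_approx[OF B g1(1), of "insert b0 S1"] S1 b0(1) by blast
    have "int b0 dvd m1" using m1[of b0] b0(2) by (simp add: mod_0_imp_dvd)
    have "int a dvd m - m1" if "a \<in> S1" for a
      using m[of a] m1[of a] g1(2)[OF that] that by (simp add: mod_eq_dvd_iff)
    then have "l dvd nat \<bar>m - m1\<bar>"
      unfolding l_def by (intro Lcm_least) (simp add: dvd_nat_abs_iff)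
    then have "int l dvd m - m1" by (simp add: dvd_nat_abs_iff)
    moreover have "int x dvd int l" "int x dvd int b0" using x by (simp_all add: c_def)
    ultimately have "int x dvd m1" "int x dvd m - m1"
      using \<open>int b0 dvd m1\<close> dvd_trans by blast+
    then have "int x dvd m" by (metis dvd_add diff_add_cancel)
    moreover have "int x dvd int b" using b(2) by simp
    ultimately show ?thesis using m[of b] by (simp add: dvd_mod)
  qed

  define g' where "g' = (\<lambda>b\<in>B. (g b * int r ^ fact b) mod int b)"
  have g'H: "g' \<in> H B" unfolding g'_def by (rule times_idempotent_in_H[OF B g])
  moreover have "g' b = g b" if b: "b \<in> S" for b
  proof -
    have bB: "b \<in> B" and bpos: "b > 0" using b S(2) B by (auto intro: gr0I)
    have bl: "b dvd l" using b by (auto simp: l_def S1_def intro: dvd_Lcm)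
    obtain x y where xy: "b = x * y" "coprime x y" "x dvd r ^ fact b" "[r ^ fact b = 1] (mod y)"
      using factorial_powers_idempotent[OF bpos, of r] by (metis dvd_refl fact_gt_zero)
    have "x dvd c"
      unfolding c_def
      by (rule dvd_gcd_of_dvd_power_quotient[where k = "fact b"])
        (use b0pos bl xy in \<open>auto simp: r_def c_def intro: dvd_trans\<close>)
    then have "int x dvd g b" using bB xy(1) by (intro c_dvd) auto
    moreover have "int y dvd int r ^ fact b - 1"
      using xy(4) by (metis cong_iff_dvd_diff cong_int_iff of_nat_1 of_nat_power)
    ultimately have "int b dvd g b * (int r ^ fact b - 1)"
      unfolding xy(1) of_nat_mult by (rule mult_dvd_mono)
    then have "int b dvd g b * int r ^ fact b - g b" by (simp add: algebra_simps)
    then have "g' b = g b mod int b" using bB by (simp add: g'_def mod_eq_dvd_iff)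
    then show ?thesis using H_mod_self[OF B g bB] by simp
  qed
  moreover have "g' \<notin> W B"
  proof -
    have "int c dvd g b0" using b0(1) by (intro c_dvd) (auto simp: c_def)
    moreover have "int r dvd int r ^ fact b0" by (simp add: dvd_power)
    ultimately have "int b0 dvd g b0 * int r ^ fact b0"
      by (subst b0cr) (simp add: mult_dvd_mono)
    then have "g' b0 = 0" using b0(1) by (simp add: g'_def)
    then show ?thesis using b0(1) by (auto simp: W_def)
  qed
  moreover have "translate B d g' \<in> W B" if d: "d \<in> D" and gd: "translate B d g \<in> W B" for d
    unfolding translate_in_W_iff[OF B g'H]
  proof (intro ballI notI)
    fix b assume bB: "b \<in> B" and "int b dvd g' b + d"
    have bpos: "b > 0" using bB B by (auto intro: gr0I)
    obtain x y where xy: "b = x * y" "coprime x y" "x dvd r ^ fact b" "[r ^ fact b = 1] (mod y)"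
      using factorial_powers_idempotent[OF bpos, of r] by (metis dvd_refl fact_gt_zero)
    have bd: "int b dvd g b * int r ^ fact b + d"
      using \<open>int b dvd g' b + d\<close> bB by (simp add: g'_def dvd_eq_mod_eq_0 mod_add_left_eq)
    \<comment> \<open>At the primes of \<open>r\<close>, \<open>g'\<close> vanishes, so the corresponding part \<open>x\<close> of \<open>b\<close> divides \<open>d\<close> and
       hence, by the choice of \<open>l\<close>, also \<open>g\<close>.\<close>
    have "int x dvd int r ^ fact b" using xy(3) by (metis int_dvd_int_iff of_nat_power)
    then have xd: "int x dvd d"
      using bd xy(1) by (metis dvd_add_right_iff dvd_mult dvd_mult_left of_nat_mult)
    then have "int x dvd int M" using dM[OF d] dvd_trans by blast
    then have "x dvd gcd b M" using xy(1) by simp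
    then have "x dvd l" using gcd_l[OF bB] dvd_trans by blast
    then have "x dvd c"
      unfolding c_def
      by (rule dvd_gcd_of_dvd_power_quotient[where k = "fact b", rotated])
        (use b0pos xy in \<open>auto simp: r_def c_def\<close>)
    then have "int x dvd g b" using bB xy(1) by (intro c_dvd) auto
    then have 1: "int x dvd g b + d" using xd by simp
    \<comment> \<open>Away from the primes of \<open>r\<close>, \<open>g'\<close> is \<open>g\<close>.\<close>
    have "int y dvd int r ^ fact b - 1"
      using xy(4) by (metis cong_iff_dvd_diff cong_int_iff of_nat_1 of_nat_power)
    moreover have "int y dvd int b" using xy(1) by simp
    then have "int y dvd g b * int r ^ fact b + d" using bd by (rule dvd_trans)
    ultimately have "int y dvd (g b * int r ^ fact b + d) - g b * (int r ^ fact b - 1)"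
      by (meson dvd_diff dvd_mult)
    then have 2: "int y dvd g b + d" by (simp add: algebra_simps)
    have "int x * int y dvd g b + d" using 1 2 xy(2) by (intro divides_mult) simp_all
    moreover have "int b = int x * int y" using xy(1) by simp
    ultimately have "int b dvd g b + d" by (simp only:)
    then show False using gd bB translate_in_W_iff[OF B g] by blast
  qed
  ultimately show ?thesis using that by blast
qed

section \<open>Prescribing finitely many positions\<close>

text \<open>Each \<open>h + n \<notin> W\<close> that has been achieved is protected from later perturbations by freezing
  one coordinate at which \<open>h + n\<close> vanishes.\<close>

lemma prescribe_positions:
  assumes B: "0 \<notin> B" and h: "h \<in> H B" and Z: "finite Z" and P: "finite P" "Z \<inter> P = {}"
    and S: "finite S" "S \<subseteq> B"
    and int: "\<And>n h'. n \<in> Z \<Longrightarrow> h' \<in> H B \<Longrightarrow> \<forall>b\<in>S. h' b = h b \<Longrightarrow>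
                translate B n h' \<notin> H_top B interior_of W B"
    and hP: "\<And>p. p \<in> P \<Longrightarrow> translate B p h \<in> W B"
  shows "\<exists>h'\<in>H B. (\<forall>b\<in>S. h' b = h b) \<and> (\<forall>n\<in>Z. translate B n h' \<notin> W B) \<and>
           (\<forall>p\<in>P. translate B p h' \<in> W B)"
  using Z P(2) int
proof (induction Z rule: finite_induct)
  case empty
  then show ?case using h hP by blast
next
  case (insert n Z)
  have "\<exists>h'\<in>H B. (\<forall>b\<in>S. h' b = h b) \<and> (\<forall>n\<in>Z. translate B n h' \<notin> W B) \<and>
          (\<forall>p\<in>P. translate B p h' \<in> W B)"
    by (rule insert.IH) (use insert.prems in auto)
  then obtain h1 where h1: "h1 \<in> H B" "\<forall>b\<in>S. h1 b = h b" "\<forall>z\<in>Z. translate B z h1 \<notin> W B"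
    "\<forall>p\<in>P. translate B p h1 \<in> W B" by blast
  have "\<forall>z\<in>Z. \<exists>b\<in>B. int b dvd h1 b + z"
    using h1(3) unfolding translate_in_W_iff[OF B h1(1)] by simp
  then obtain \<beta> where \<beta>: "\<And>z. z \<in> Z \<Longrightarrow> \<beta> z \<in> B \<and> int (\<beta> z) dvd h1 (\<beta> z) + z" by metis
  define S' where "S' = S \<union> \<beta> ` Z"
  have S': "finite S'" "S' \<subseteq> B" using S \<beta> insert.hyps by (auto simp: S'_def)
  define D where "D = (\<lambda>p. p - n) ` P"
  have D: "finite D" "0 \<notin> D" using P(1) insert.prems(1) by (auto simp: D_def)
  have "translate B n h1 \<notin> H_top B interior_of W B" using insert.prems(2) h1 by blast
  from perturb_out_of_window[OF B translate_in_H[OF B h1(1)] this S' D]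
  obtain g where g: "g \<in> H B" "\<And>b. b \<in> S' \<Longrightarrow> g b = translate B n h1 b" "g \<notin> W B"
    "\<And>d. d \<in> D \<Longrightarrow> translate B d (translate B n h1) \<in> W B \<Longrightarrow> translate B d g \<in> W B" by metis
  define h2 where "h2 = translate B (- n) g"
  have h2H: "h2 \<in> H B" unfolding h2_def by (rule translate_in_H[OF B g(1)])
  have h2t: "translate B m h2 = translate B (m - n) g" for m
    unfolding h2_def translate_translate by (simp add: add.commute)
  have h2S: "h2 b = h1 b" if b: "b \<in> S'" for b
  proof -
    have bB: "b \<in> B" using b S' by blast
    have "h2 b = translate B (- n) (translate B n h1) b" using g(2)[OF b] bB by (simp add: h2_def translate_apply)
    then show ?thesis unfolding translate_translate using translate_zero[OF B h1(1)] by simp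
  qed
  show ?case
  proof (intro bexI[of _ h2] conjI ballI)
    fix b assume "b \<in> S" then show "h2 b = h b" using h2S[of b] h1(2) by (simp add: S'_def)
  next
    fix z assume z: "z \<in> insert n Z"
    show "translate B z h2 \<notin> W B"
    proof (cases "z = n")
      case True
      then show ?thesis unfolding h2t using g(3) translate_zero[OF B g(1)] by simp
    next
      case False
      then have "z \<in> Z" using z by simp
      then have "\<beta> z \<in> B" "int (\<beta> z) dvd h2 (\<beta> z) + z"
        using \<beta>[of z] h2S[of "\<beta> z"] by (simp_all add: S'_def)
      then show ?thesis unfolding translate_in_W_iff[OF B h2H] by blast
    qed
  next
    fix p assume p: "p \<in> P"
    have "translate B (p - n) (translate B n h1) = translate B p h1"
      unfolding translate_translate by simp
    then show "translate B p h2 \<in> W B"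
      unfolding h2t using g(4)[of "p - n"] h1(4) p by (simp add: D_def)
  qed (rule h2H)
qed

section \<open>The coding interval\<close>

lemma in_closure_of_shift_space_iff:
  assumes "Y \<subseteq> topspace shift_space"
  shows "x \<in> shift_space closure_of Y \<longleftrightarrow>
    x \<in> topspace shift_space \<and> (\<forall>N. finite N \<longrightarrow> (\<exists>y\<in>Y. \<forall>n\<in>N. y n = x n))"
  using in_closure_of_product_discrete_iff[of Y UNIV "\<lambda>_. {0, 1}" x] assms
  unfolding shift_space_def by simp

lemma coding_in_shift_space: "coding B A h \<in> topspace shift_space"
  by (auto simp: shift_space_def coding_eq split: if_split_asm)

lemma coding_interval_subset_X_phi:
  assumes B: "0 \<notin> B"
  shows "coding_interval B \<subseteq> X_phi B"
proof
  fix x assume "x \<in> coding_interval B"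
  then obtain h where x: "x \<in> topspace shift_space" and h: "h \<in> H B"
    and lower: "coding B (W' B) h \<le> x" and upper: "x \<le> coding B (W B) h"
    unfolding coding_interval_def by blast
  have x01: "x n = 0 \<or> x n = 1" for n
    using x by (auto simp: shift_space_def PiE_iff)
  have zero: "translate B n h \<notin> W' B" if "x n = 0" for n
    using le_funD[OF lower, of n] that by (auto simp: coding_eq split: if_splits)
  have one: "translate B p h \<in> W B" if "x p = 1" for p
    using le_funD[OF upper, of p] that by (auto simp: coding_eq split: if_splits)
  have "\<exists>h'\<in>H B. \<forall>n\<in>N. coding B (W B) h' n = x n" if N: "finite N" for N
  proof -
    define Z where "Z = {n \<in> N. x n = 0}"
    define P where "P = {n \<in> N. x n = 1}"
    have "\<forall>n\<in>Z. \<exists>S. finite S \<and> S \<subseteq> B \<and> (\<forall>g. g \<in> H B \<longrightarrow>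
        (\<forall>b\<in>S. g b = translate B n h b) \<longrightarrow> g \<notin> H_top B interior_of W B)"
    proof
      fix n assume "n \<in> Z"
      then have "translate B n h \<notin> W' B" by (simp add: Z_def zero)
      from not_in_W'_neighbourhood[OF translate_in_H[OF B h] this]
      show "\<exists>S. finite S \<and> S \<subseteq> B \<and> (\<forall>g. g \<in> H B \<longrightarrow>
        (\<forall>b\<in>S. g b = translate B n h b) \<longrightarrow> g \<notin> H_top B interior_of W B)" by metis
    qed
    then obtain s where s: "\<And>n. n \<in> Z \<Longrightarrow> finite (s n) \<and> s n \<subseteq> B"
      "\<And>n g. n \<in> Z \<Longrightarrow> g \<in> H B \<Longrightarrow> \<forall>b\<in>s n. g b = translate B n h b \<Longrightarrow>
         g \<notin> H_top B interior_of W B" by metis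
    have "\<exists>h'\<in>H B. (\<forall>b\<in>\<Union>(s ` Z). h' b = h b) \<and> (\<forall>n\<in>Z. translate B n h' \<notin> W B) \<and>
           (\<forall>p\<in>P. translate B p h' \<in> W B)"
    proof (rule prescribe_positions[OF B h])
      show "finite Z" "finite P" "Z \<inter> P = {}" using N by (auto simp: Z_def P_def)
      then show "finite (\<Union>(s ` Z))" "\<Union>(s ` Z) \<subseteq> B" using s(1) by auto
      show "translate B p h \<in> W B" if "p \<in> P" for p using that one by (simp add: P_def)
      show "translate B n h' \<notin> H_top B interior_of W B"
        if "n \<in> Z" "h' \<in> H B" "\<forall>b\<in>\<Union>(s ` Z). h' b = h b" for n h'
      proof (rule s(2)[OF that(1) translate_in_H[OF B that(2)]], intro ballI)
        fix b assume "b \<in> s n"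
        then have "b \<in> B" "h' b = h b" using that(1,3) s(1)[OF that(1)] by auto
        then show "translate B n h' b = translate B n h b" by (simp add: translate_apply)
      qed
    qed
    then show ?thesis
      using x01 by (force simp: coding_eq Z_def P_def)
  qed
  then show "x \<in> X_phi B"
    unfolding X_phi_def using x coding_in_shift_space
    by (subst in_closure_of_shift_space_iff) blast+
qed

theorem theorem1:
  fixes B :: "nat set"
  assumes "B \<subseteq> {1..}" and "B \<noteq> {}" and "primitive B"
  shows "coding B (W B) ` H B \<subseteq> coding_interval B
       \<and> coding_interval B \<subseteq> X_phi B
       \<and> X_phi B = shift_space closure_of (coding_interval B)"
proof (intro conjI)
  have B: "0 \<notin> B" using assms(1) by auto
  show 1: "coding B (W B) ` H B \<subseteq> coding_interval B"
  proof
    fix x assume "x \<in> coding B (W B) ` H B"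
    then obtain h where h: "h \<in> H B" "x = coding B (W B) h" by blast
    have "coding B (W' B) h \<le> coding B (W B) h"
      using W'_subset_W by (auto simp: le_fun_def coding_eq)
    with h show "x \<in> coding_interval B"
      unfolding coding_interval_def using coding_in_shift_space by auto
  qed
  show 2: "coding_interval B \<subseteq> X_phi B"
    by (rule coding_interval_subset_X_phi[OF B])
  show "X_phi B = shift_space closure_of (coding_interval B)"
  proof
    show "X_phi B \<subseteq> shift_space closure_of (coding_interval B)"
      unfolding X_phi_def by (rule closure_of_mono[OF 1])
    show "shift_space closure_of (coding_interval B) \<subseteq> X_phi B"
      using 2 unfolding X_phi_def by (simp add: closure_of_minimal)
  qed
qed

end
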